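(* Let $X\in\mathbb{R}^{n\times n}_+$ and let $a,b$ be two real constants not equal to zero. Then $$\mathcal{P}_{sk}\big(X^{\circ(ab)}\big)=\mathcal{P}_{sk}\big(\mathcal{P}_{sk}(X^{\circ a})^{\circ b}\big).$$
   Context: $\mathbb{R}^{n\times n}_+$ (resp. $\mathbb{R}^n_+$) denotes the real $n\times n$ matrices (resp. $n$-vectors) with all entries strictly positive. For a vector $\mathbf{x}$, $D_{(\mathbf{x})}$ is the diagonal matrix with diagonal $\mathbf{x}$. A matrix is doubly stochastic if it is entrywise nonnegative with all row sums and all column sums equal to $1$. Hadamard power: $Y^{\circ p}$ is the matrix with entries $Y_{ij}^p$. Sinkhorn operator: for $Y\in\mathbb{R}^{n\times n}_+$, $\mathcal{P}_{sk}(Y)=D_{(\mathbf r)}YD_{(\mathbf c)}$, where $\mathbf r,\mathbf c\in\mathbb{R}^n_+$ are balancing vectors, i.e. such that $D_{(\mathbf r)}YD_{(\mathbf c)}$ is doubly stochastic (by Sinkhorn's theorem such vectors exist and the resulting doubly stochastic matrix is unique). *)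

theory Defs
  imports "HOL-Analysis.Analysis"
begin

definition positive_vec :: "real ^ 'n \<Rightarrow> bool" where
  "positive_vec x \<longleftrightarrow> (\<forall>i. 0 < x $ i)"

definition positive_mat :: "real ^ 'n ^ 'n \<Rightarrow> bool" where
  "positive_mat Y \<longleftrightarrow> (\<forall>i j. 0 < Y $ i $ j)"

definition diag_mat :: "real ^ 'n \<Rightarrow> real ^ 'n ^ 'n" where
  "diag_mat x = (\<chi> i j. if i = j then x $ i else 0)"

definition doubly_stochastic :: "real ^ 'n ^ 'n \<Rightarrow> bool" where
  "doubly_stochastic Y \<longleftrightarrow>
     (\<forall>i j. 0 \<le> Y $ i $ j) \<and>
     (\<forall>i. (\<Sum>j\<in>UNIV. Y $ i $ j) = 1) \<and>
     (\<forall>j. (\<Sum>i\<in>UNIV. Y $ i $ j) = 1)"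

(* The real power is the intended one only for positive entries,
   since (powr) maps base 0 to 0 for every exponent. *)
definition hadamard_power :: "real ^ 'n ^ 'n \<Rightarrow> real \<Rightarrow> real ^ 'n ^ 'n" where
  "hadamard_power Y p = (\<chi> i j. (Y $ i $ j) powr p)"

definition balancing_vectors :: "real ^ 'n ^ 'n \<Rightarrow> real ^ 'n \<Rightarrow> real ^ 'n \<Rightarrow> bool" where
  "balancing_vectors Y r c \<longleftrightarrow>
     positive_vec r \<and> positive_vec c \<and> doubly_stochastic (diag_mat r ** Y ** diag_mat c)"

(* Balancing vectors are unique only up to r \<mapsto> t r, c \<mapsto> c / t, so the description
   ranges over the scaled matrix. By Sinkhorn's theorem it denotes exactly one matrix
   whenever Y is entrywise positive; otherwise the value may be unspecified. *)
definition sinkhorn :: "real ^ 'n ^ 'n \<Rightarrow> real ^ 'n ^ 'n" where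
  "sinkhorn Y = (THE Z. \<exists>r c. balancing_vectors Y r c \<and> Z = diag_mat r ** Y ** diag_mat c)"

end

theory Submission
  imports Defs
begin

text \<open>
  Two matrices that are diagonally equivalent by positive diagonal matrices have the same doubly
  stochastic scalings. The Hadamard power turns a positive diagonal scaling of \<open>X\<^sup>a\<close> into one of
  \<open>X\<^sup>a\<^sup>b\<close>, so it only remains to know that the inner Sinkhorn operator really is a scaling
  of \<open>X\<^sup>a\<close>, that is, Sinkhorn's theorem. Existence comes from Brouwer's theorem on the
  simplex, uniqueness from a maximum principle.
\<close>

lemma diag_mat_scaling_nth [simp]:
  "(diag_mat r ** Y ** diag_mat c) $ i $ j = r $ i * Y $ i $ j * c $ j"
  by (simp add: diag_mat_def matrix_matrix_mult_def if_distrib if_distribR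
      sum.delta sum.delta' cong: if_cong)

text \<open>The terms \<open>w j * (c j - m)\<close> are nonnegative and add up to at most 0, so all
  of them vanish; strict positivity of the weights then forces equality at every
  \<open>j\<close>.\<close>

lemma weighted_average_eq_min:
  fixes w c :: "'n::finite \<Rightarrow> real"
  assumes "\<And>j. 0 < w j" "sum w UNIV = 1" "\<And>j. m \<le> c j" "(\<Sum>j\<in>UNIV. w j * c j) \<le> m"
  shows "c j = m"
proof -
  have "(\<Sum>j\<in>UNIV. w j * (c j - m)) = (\<Sum>j\<in>UNIV. w j * c j) - m"
    using assms(2) by (simp add: right_diff_distrib sum_subtractf flip: sum_distrib_right)
  moreover have nonneg: "0 \<le> w j * (c j - m)" for j
    using assms(1,3) by (simp add: less_imp_le)
  ultimately have "(\<Sum>j\<in>UNIV. w j * (c j - m)) = 0"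
    using assms(4) sum_nonneg[of UNIV "\<lambda>j. w j * (c j - m)"] by auto
  then have "w j * (c j - m) = 0"
    using nonneg by (simp add: sum_nonneg_eq_0_iff)
  then show ?thesis
    using assms(1)[of j] by auto
qed

text \<open>Maximum principle: the largest entry of \<open>r\<close> is played against the smallest
  entry of \<open>c\<close>. Rows and columns of \<open>Z\<close> act as averaging weights, and the
  two estimates are compatible only if \<open>c\<close> is constant; the row sums then make
  \<open>r\<close> the constant reciprocal.\<close>

lemma doubly_stochastic_scaling_trivial:
  fixes Z :: "real ^ 'n ^ 'n"
  assumes Z: "positive_mat Z" "doubly_stochastic Z" and bal: "balancing_vectors Z r c"
  shows "diag_mat r ** Z ** diag_mat c = Z"
proof -
  have r: "0 < r $ i" and c: "0 < c $ i" for i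
    using bal by (auto simp: balancing_vectors_def positive_vec_def)
  have row: "r $ i * (\<Sum>j\<in>UNIV. Z $ i $ j * c $ j) = 1" for i
    using bal by (simp add: balancing_vectors_def doubly_stochastic_def sum_distrib_left mult.assoc)
  have col: "(\<Sum>i\<in>UNIV. Z $ i $ j * r $ i) * c $ j = 1" for j
    using bal by (simp add: balancing_vectors_def doubly_stochastic_def sum_distrib_left
        mult_ac)
  define R where "R = Max (range (($) r))"
  define m where "m = Min (range (($) c))"
  have "R \<in> range (($) r)" unfolding R_def by (intro Max_in) auto
  then obtain i0 where i0: "R = r $ i0" by blast
  have "m \<in> range (($) c)" unfolding m_def by (intro Min_in) auto
  then obtain j0 where j0: "m = c $ j0" by blast
  have R: "r $ i \<le> R" and m: "m \<le> c $ i" for i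
    by (simp_all add: R_def m_def)
  have pos: "0 < R" "0 < m" using r c by (auto simp: i0 j0)
  \<comment> \<open>By \<open>col\<close>, the average of \<open>r\<close> with the weights of
    column \<open>j0\<close> is \<open>1 / m\<close>, and an average of \<open>r\<close> cannot
    exceed \<open>R\<close>.\<close>
  have "(\<Sum>i\<in>UNIV. Z $ i $ j0 * r $ i) \<le> (\<Sum>i\<in>UNIV. Z $ i $ j0 * R)"
    using Z(1) by (intro sum_mono mult_left_mono R) (auto simp: positive_mat_def less_imp_le)
  also have "\<dots> = R"
    using Z(2) by (simp add: doubly_stochastic_def flip: sum_distrib_right)
  finally have "(\<Sum>i\<in>UNIV. Z $ i $ j0 * r $ i) * m \<le> R * m"
    using pos by (intro mult_right_mono) auto
  then have "1 \<le> R * m"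
    using col[of j0] by (simp add: j0)
  \<comment> \<open>By \<open>row\<close>, the average of \<open>c\<close> with the weights of row
    \<open>i0\<close> is \<open>1 / R\<close>, hence at most the minimum \<open>m\<close> of
    \<open>c\<close>: the equality case.\<close>
  then have "R * (\<Sum>j\<in>UNIV. Z $ i0 $ j * c $ j) \<le> R * m"
    using row[of i0] by (simp add: i0)
  then have "(\<Sum>j\<in>UNIV. Z $ i0 $ j * c $ j) \<le> m"
    using pos by simp
  then have c_const: "c $ j = m" for j
    using weighted_average_eq_min[of "\<lambda>j. Z $ i0 $ j" m "($) c"] Z m
    by (auto simp: positive_mat_def doubly_stochastic_def)
  have "r $ i * m = 1" for i
    using row[of i] Z(2) by (simp add: c_const doubly_stochastic_def flip: sum_distrib_right)
  then have "r $ i * Z $ i $ j * m = Z $ i $ j" for i j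
    by (simp add: mult.commute[of "r $ i"] mult.assoc)
  then show ?thesis
    by (simp add: vec_eq_iff c_const)
qed

text \<open>Vectors multiply componentwise here, which is how successive diagonal scalings
  compose.\<close>

lemma balancing_vectors_diag_scaling:
  assumes "positive_vec s" "positive_vec d"
  shows "balancing_vectors (diag_mat s ** Y ** diag_mat d) r c \<longleftrightarrow>
    positive_vec r \<and> positive_vec c \<and> balancing_vectors Y (r * s) (c * d)"
  using assms by (auto simp: balancing_vectors_def positive_vec_def doubly_stochastic_def mult_ac)

text \<open>Positive diagonal matrices have positive diagonal inverses, so a scaling can be undone.
  The form, an equivalence for each \<open>Z\<close>, matches the predicate under \<open>THE\<close>
  in \<open>sinkhorn\<close>.\<close>

lemma scaled_matrices_diag_scaling:
  fixes Y :: "real ^ 'n ^ 'n"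
  assumes s: "positive_vec s" and d: "positive_vec d"
  defines "Y' \<equiv> diag_mat s ** Y ** diag_mat d"
  shows "(\<exists>r c. balancing_vectors Y' r c \<and> Z = diag_mat r ** Y' ** diag_mat c) \<longleftrightarrow>
    (\<exists>r c. balancing_vectors Y r c \<and> Z = diag_mat r ** Y ** diag_mat c)" (is "?L \<longleftrightarrow> ?R")
proof
  assume ?L
  then obtain r c where bal: "balancing_vectors Y' r c" and Z: "Z = diag_mat r ** Y' ** diag_mat c"
    by blast
  have "balancing_vectors Y (r * s) (c * d)"
    using bal balancing_vectors_diag_scaling[OF s d] by (simp add: Y'_def)
  moreover have "Z = diag_mat (r * s) ** Y ** diag_mat (c * d)"
    by (simp add: Z Y'_def vec_eq_iff mult_ac)
  ultimately show ?R by blast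
next
  assume ?R
  then obtain r c where bal: "balancing_vectors Y r c" and Z: "Z = diag_mat r ** Y ** diag_mat c"
    by blast
  define r' c' where "r' = (\<chi> i. r $ i / s $ i)" and "c' = (\<chi> i. c $ i / d $ i)"
  have nz: "s $ i \<noteq> 0" "d $ i \<noteq> 0" for i
    using s d by (auto simp: positive_vec_def dest: spec[of _ i])
  have rs: "r' * s = r" "c' * d = c"
    using nz by (simp_all add: vec_eq_iff r'_def c'_def)
  have "positive_vec r'" "positive_vec c'"
    using bal s d by (auto simp: balancing_vectors_def positive_vec_def r'_def c'_def)
  then have "balancing_vectors Y' r' c'"
    using bal balancing_vectors_diag_scaling[OF s d] by (simp add: Y'_def rs)
  moreover have "Z = diag_mat r' ** Y' ** diag_mat c'"
    using nz by (simp add: Z Y'_def vec_eq_iff r'_def c'_def)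
  ultimately show ?L by blast
qed

lemma sinkhorn_diag_scaling:
  assumes "positive_vec s" "positive_vec d"
  shows "sinkhorn (diag_mat s ** Y ** diag_mat d) = sinkhorn Y"
  unfolding sinkhorn_def using scaled_matrices_diag_scaling[OF assms] by simp

text \<open>Existence half of Sinkhorn's theorem: Brouwer yields a fixed point, up to a scalar, of
  one step of Sinkhorn's iteration.\<close>

lemma balancing_vectors_exist:
  fixes Y :: "real ^ 'n ^ 'n"
  assumes "positive_mat Y"
  shows "\<exists>r c. balancing_vectors Y r c"
proof -
  have Y: "0 < Y $ i $ j" for i j
    using assms by (simp add: positive_mat_def)
  define S where "S = {c :: real ^ 'n. (\<forall>j. 0 \<le> c $ j) \<and> (\<Sum>j\<in>UNIV. c $ j) = 1}"
  \<comment> \<open>For a column factor \<open>c\<close>, \<open>r c\<close> is the row factor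
    making all row sums 1; \<open>T c\<close> is the column factor that, paired with
    \<open>r c\<close>, makes all column sums 1; \<open>f\<close> brings \<open>T c\<close> back to
    the simplex \<open>S\<close>.\<close>
  define r where "r c = (\<chi> i. 1 / (\<Sum>k\<in>UNIV. Y $ i $ k * c $ k))" for c
  define T where "T c = (\<chi> j. 1 / (\<Sum>i\<in>UNIV. Y $ i $ j * r c $ i))" for c
  define f where "f c = (1 / (\<Sum>j\<in>UNIV. T c $ j)) *\<^sub>R T c" for c
  \<comment> \<open>On the boundary of the simplex some entries of \<open>c\<close> vanish, but not
    all, so the denominators in \<open>r\<close> stay positive and \<open>f\<close> is continuous on
    all of \<open>S\<close>.\<close>
  have Yc_pos: "0 < (\<Sum>k\<in>UNIV. Y $ i $ k * c $ k)" if "c \<in> S" for c i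
  proof -
    have "\<exists>k. c $ k \<noteq> 0"
      by (rule ccontr) (use that in \<open>simp add: S_def\<close>)
    then obtain k where "c $ k \<noteq> 0" ..
    with that have "0 < c $ k" by (simp add: S_def less_le)
    with that Y show ?thesis
      by (intro sum_pos2[of _ k]) (auto simp: S_def less_imp_le)
  qed
  have r_pos: "0 < r c $ i" if "c \<in> S" for c i
    using Yc_pos[OF that] by (simp add: r_def)
  have Yr_pos: "0 < (\<Sum>i\<in>UNIV. Y $ i $ j * r c $ i)" if "c \<in> S" for c j
    using Y r_pos[OF that] by (intro sum_pos) auto
  have T_pos: "0 < T c $ j" if "c \<in> S" for c j
    using Yr_pos[OF that] by (simp add: T_def)
  have sum_T_pos: "0 < (\<Sum>j\<in>UNIV. T c $ j)" if "c \<in> S" for c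
    using T_pos[OF that] by (intro sum_pos) auto
  have "compact S"
  proof -
    have "bounded S"
    proof (rule boundedI)
      fix c assume c: "c \<in> S"
      have "norm c \<le> (\<Sum>j\<in>UNIV. \<bar>c $ j\<bar>)" by (rule norm_le_l1_cart)
      also have "\<dots> = 1" using c by (simp add: S_def)
      finally show "norm c \<le> 1" .
    qed
    moreover have "closed S"
      unfolding S_def by (intro closed_Collect_conj closed_Collect_all closed_Collect_le
          closed_Collect_eq continuous_intros)
    ultimately show ?thesis by (simp add: compact_eq_bounded_closed)
  qed
  moreover have "convex S"
    by (auto simp: convex_def S_def sum.distrib simp flip: sum_distrib_left)
  moreover have "S \<noteq> {}"
  proof -
    have "(\<chi> j. 1 / real CARD('n)) \<in> S" by (simp add: S_def)
    then show ?thesis by blast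
  qed
  moreover have "continuous_on S f"
  proof -
    have "continuous_on S (\<lambda>c. r c $ i)" for i
      unfolding r_def vec_lambda_beta
      by (intro continuous_intros ballI) (use Yc_pos in \<open>simp add: less_imp_neq[symmetric]\<close>)
    then have T: "continuous_on S (\<lambda>c. T c $ j)" for j
      unfolding T_def vec_lambda_beta
      by (intro continuous_on_divide continuous_on_sum continuous_on_mult continuous_on_const ballI)
        (use Yr_pos in \<open>simp_all add: less_imp_neq[symmetric]\<close>)
    then have "continuous_on S T"
      using continuous_on_vec_lambda[of S "\<lambda>j c. T c $ j"] by simp
    with T show ?thesis
      unfolding f_def
      by (intro continuous_intros ballI) (use sum_T_pos in \<open>simp_all add: less_imp_neq[symmetric]\<close>)
  qed
  moreover have "f \<in> S \<rightarrow> S"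
  proof
    fix c assume c: "c \<in> S"
    show "f c \<in> S"
      using T_pos[OF c] sum_T_pos[OF c]
      by (auto simp: f_def S_def less_imp_le simp flip: sum_divide_distrib)
  qed
  ultimately obtain c where c: "c \<in> S" "f c = c"
    using brouwer by metis
  define \<mu> where "\<mu> = 1 / (\<Sum>j\<in>UNIV. T c $ j)"
  have c_eq: "c $ j = \<mu> * T c $ j" for j
    using c(2) by (metis f_def \<mu>_def vector_scaleR_component real_scaleR_def)
  \<comment> \<open>A fixed point is a positive multiple of \<open>T c\<close>, so it lies in the
    interior of the simplex.\<close>
  have c_pos: "0 < c $ j" for j
    using c_eq T_pos[OF c(1)] sum_T_pos[OF c(1)] by (simp add: \<mu>_def)
  have row: "(\<Sum>j\<in>UNIV. r c $ i * Y $ i $ j * c $ j) = 1" for i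
    using Yc_pos[OF c(1), of i]
    by (simp add: mult.assoc r_def flip: sum_divide_distrib)
  \<comment> \<open>With \<open>T c\<close> in place of \<open>c\<close> the column sums would be 1;
    the fixed point differs from it by the factor \<open>\<mu>\<close>.\<close>
  have col: "(\<Sum>i\<in>UNIV. r c $ i * Y $ i $ j * c $ j) = \<mu>" for j
  proof -
    have "(\<Sum>i\<in>UNIV. r c $ i * Y $ i $ j * c $ j) = (\<Sum>i\<in>UNIV. Y $ i $ j * r c $ i) * c $ j"
      by (simp add: sum_distrib_left mult_ac)
    then show ?thesis
      using Yr_pos[OF c(1), of j] by (simp add: c_eq[of j]) (simp add: T_def)
  qed
  \<comment> \<open>Summing all entries by rows and by columns shows that the normalising factor is 1.\<close>
  have "real CARD('n) = (\<Sum>i\<in>UNIV. \<Sum>j\<in>UNIV. r c $ i * Y $ i $ j * c $ j)"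
    by (simp add: row)
  also have "\<dots> = (\<Sum>j\<in>UNIV. \<Sum>i\<in>UNIV. r c $ i * Y $ i $ j * c $ j)"
    by (rule sum.swap)
  also have "\<dots> = real CARD('n) * \<mu>"
    by (simp add: col)
  finally have "\<mu> = 1" by simp
  then have "balancing_vectors Y (r c) c"
    using row col r_pos[OF c(1)] c_pos Y
    by (simp add: balancing_vectors_def positive_vec_def doubly_stochastic_def less_imp_le)
  then show ?thesis by blast
qed

lemma positive_mat_diag_scaling:
  assumes "positive_mat Y" "positive_vec r" "positive_vec c"
  shows "positive_mat (diag_mat r ** Y ** diag_mat c)"
  using assms by (simp add: positive_mat_def positive_vec_def)

text \<open>Uniqueness reduces to the doubly stochastic case: any other doubly stochastic scaling of
  \<open>Y\<close> is also a scaling of \<open>?Z\<close>, and such a scaling leaves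
  \<open>?Z\<close> unchanged.\<close>

lemma sinkhorn_eqI:
  fixes Y :: "real ^ 'n ^ 'n"
  assumes Y: "positive_mat Y" and bal: "balancing_vectors Y r c"
  shows "sinkhorn Y = diag_mat r ** Y ** diag_mat c" (is "_ = ?Z")
proof -
  have rc: "positive_vec r" "positive_vec c" and "doubly_stochastic ?Z"
    using bal by (auto simp: balancing_vectors_def)
  moreover have "positive_mat ?Z"
    by (rule positive_mat_diag_scaling) fact+
  ultimately have trivial: "diag_mat s ** ?Z ** diag_mat d = ?Z"
    if "balancing_vectors ?Z s d" for s d
    using that by (intro doubly_stochastic_scaling_trivial)
  show ?thesis
    unfolding sinkhorn_def
  proof (rule the_equality)
    show "\<exists>s d. balancing_vectors Y s d \<and> ?Z = diag_mat s ** Y ** diag_mat d"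
      using bal by (intro exI conjI) auto
    fix W assume "\<exists>s d. balancing_vectors Y s d \<and> W = diag_mat s ** Y ** diag_mat d"
    then have "\<exists>s d. balancing_vectors ?Z s d \<and> W = diag_mat s ** ?Z ** diag_mat d"
      by (rule scaled_matrices_diag_scaling[OF rc, THEN iffD2])
    then obtain s d where "balancing_vectors ?Z s d" "W = diag_mat s ** ?Z ** diag_mat d"
      by (elim exE conjE)
    with trivial show "W = ?Z" by simp
  qed
qed

lemma hadamard_power_diag_scaling:
  assumes "positive_mat Y" "positive_vec r" "positive_vec c"
  shows "hadamard_power (diag_mat r ** Y ** diag_mat c) p =
    diag_mat (\<chi> i. r $ i powr p) ** hadamard_power Y p ** diag_mat (\<chi> j. c $ j powr p)"
  using assms
  by (simp add: vec_eq_iff hadamard_power_def positive_mat_def positive_vec_def powr_mult less_imp_le)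

theorem lemma3:
  fixes X :: "real ^ 'n ^ 'n" and a b :: real
  assumes "positive_mat X"
    and "a \<noteq> 0" and "b \<noteq> 0"
  shows "sinkhorn (hadamard_power X (a * b)) =
         sinkhorn (hadamard_power (sinkhorn (hadamard_power X a)) b)"
proof -
  have X: "0 < X $ i $ j" for i j
    using assms(1) by (simp add: positive_mat_def)
  have pos: "positive_mat (hadamard_power X a)"
    using X by (simp add: positive_mat_def hadamard_power_def less_imp_neq[symmetric])
  then obtain r c where bal: "balancing_vectors (hadamard_power X a) r c"
    using balancing_vectors_exist by blast
  then have rc: "positive_vec r" "positive_vec c"
    by (auto simp: balancing_vectors_def)
  \<comment> \<open>The inner value is an explicit scaling of the power \<open>a\<close> of
    \<open>X\<close>; its factors, raised to the power \<open>b\<close>, are still positive and are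
    absorbed by the outer operator.\<close>
  have "sinkhorn (hadamard_power (sinkhorn (hadamard_power X a)) b) =
      sinkhorn (hadamard_power (hadamard_power X a) b)"
    unfolding sinkhorn_eqI[OF pos bal] hadamard_power_diag_scaling[OF pos rc]
    using rc by (intro sinkhorn_diag_scaling) (auto simp: positive_vec_def less_imp_neq[symmetric])
  also have "hadamard_power (hadamard_power X a) b = hadamard_power X (a * b)"
    by (simp add: hadamard_power_def powr_powr)
  finally show ?thesis ..
qed

end
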